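(* Let $n,m,N\ge 1$ be integers, $A\in\mathbb R^{n\times n}$, $B\in\mathbb R^{n\times m}$, and let $Q_f,Q,W_f,W\in\mathbb S^n$, $R\in\mathbb S^m$ satisfy $Q_f\succeq 0$, $Q\succeq 0$, $R\succ 0$, $W_f\succ 0$, $W\succ 0$. Let $p_{\rm opt}$ be the optimal value of the primal problem and $d_{\rm opt}$ the optimal value of its Lagrangian dual problem, both defined in the context. Then strong duality holds, i.e. $p_{\rm opt}=d_{\rm opt}$.
   Context: $\mathbb S^r$ denotes the real symmetric $r\times r$ matrices, $\mathbb S^r_+$ the positive semidefinite ones; $\succeq,\succ$ are the (strict) semidefinite orders. For $F\in\mathbb R^{m\times n}$ and $S\in\mathbb S^{n+m}$ put $$\Phi(F,S):=\begin{bmatrix} I_n \\ F\end{bmatrix}\left(\begin{bmatrix}A & B\end{bmatrix}S\begin{bmatrix}A & B\end{bmatrix}^T+W\right)\begin{bmatrix} I_n \\ F\end{bmatrix}^T ,$$ and for $S_0,\dots,S_{N-1}\in\mathbb S^{n+m}$ put $$J_p(\{S_k\}_{k=0}^{N-1}):=\mathrm{Tr}\left(Q_f\left(\begin{bmatrix}A & B\end{bmatrix}S_{N-1}\begin{bmatrix}A & B\end{bmatrix}^T+W\right)\right)+\sum_{k=0}^{N-1}\mathrm{Tr}\left(\begin{bmatrix}Q&0 \\ 0&R\end{bmatrix}S_k\right).$$ Primal problem: $p_{\rm opt}$ is the optimal value of minimizing $J_p(\{S_k\}_{k=0}^{N-1})$ over $S_0,\dots,S_{N-1}\in\mathbb S^{n+m}$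 and $F_0,\dots,F_{N-1}\in\mathbb R^{m\times n}$ subject to $$\Phi(F_k,S_{k-1})\preceq S_k\ \ (k=1,\dots,N-1),\qquad \begin{bmatrix} I_n \\ F_0\end{bmatrix}W_f\begin{bmatrix} I_n \\ F_0\end{bmatrix}^T\preceq S_0 .$$ Lagrangian: for $P_k,\bar P_k\in\mathbb S^{n+m}_+$ ($k=0,\dots,N-1$), $$L(\{(S_k,F_k,P_k,\bar P_k)\}_{k=0}^{N-1}):=J_p(\{S_k\})+\sum_{k=1}^{N-1}\mathrm{Tr}\big((\Phi(F_k,S_{k-1})-S_k)P_k\big)+\mathrm{Tr}\left(\left(\begin{bmatrix} I_n \\ F_0\end{bmatrix}W_f\begin{bmatrix} I_n \\ F_0\end{bmatrix}^T-S_0\right)P_0\right)-\sum_{k=0}^{N-1}\mathrm{Tr}(S_k\bar P_k).$$ Dual problem: $$d_{\rm opt}:=\sup_{P_k\succeq 0,\ \bar P_k\succeq 0\ (0\le k\le N-1)}\ \ \inf_{S_k\in\mathbb S^{n+m},\ F_k\in\mathbb R^{m\times n}\ (0\le k\le N-1)}L(\{(S_k,F_k,P_k,\bar P_k)\}_{k=0}^{N-1}),$$ where the inner infimum may be $-\infty$. *)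

theory Defs
  imports "HOL-Analysis.Analysis"
begin

text \<open>
  A real matrix with r rows and c columns is an element of \<open>real ^ 'c ^ 'r\<close> with
  \<open>CARD('c) = c\<close> and \<open>CARD('r) = r\<close>; vectors and matrices of size \<open>n + m\<close> are indexed by the
  sum type \<open>'n + 'm\<close>, \<open>Inl\<close> addressing the first block and \<open>Inr\<close> the second.
\<close>

definition symmetric_mat :: "real ^ 'r ^ 'r \<Rightarrow> bool" where
  "symmetric_mat X \<longleftrightarrow> transpose X = X"

definition psd :: "real ^ 'r ^ 'r \<Rightarrow> bool" where
  "psd X \<longleftrightarrow> symmetric_mat X \<and> (\<forall>x. x \<bullet> (X *v x) \<ge> 0)"

definition pd :: "real ^ 'r ^ 'r \<Rightarrow> bool" where
  "pd X \<longleftrightarrow> symmetric_mat X \<and> (\<forall>x. x \<noteq> 0 \<longrightarrow> x \<bullet> (X *v x) > 0)"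

definition loewner_le :: "real ^ 'r ^ 'r \<Rightarrow> real ^ 'r ^ 'r \<Rightarrow> bool" (infix "\<preceq>" 50) where
  "X \<preceq> Y \<longleftrightarrow> psd (Y - X)"

definition hcat :: "real ^ 'n ^ 'r \<Rightarrow> real ^ 'm ^ 'r \<Rightarrow> real ^ ('n + 'm) ^ 'r" where
  "hcat X Y = (\<chi> i j. case j of Inl a \<Rightarrow> X $ i $ a | Inr b \<Rightarrow> Y $ i $ b)"

definition vcat :: "real ^ 'c ^ 'n \<Rightarrow> real ^ 'c ^ 'm \<Rightarrow> real ^ 'c ^ ('n + 'm)" where
  "vcat X Y = (\<chi> i j. case i of Inl a \<Rightarrow> X $ a $ j | Inr b \<Rightarrow> Y $ b $ j)"

definition block_diag ::
  "real ^ 'n ^ 'n \<Rightarrow> real ^ 'm ^ 'm \<Rightarrow> real ^ ('n + 'm) ^ ('n + 'm)" where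
  "block_diag X Y = vcat (hcat X 0) (hcat 0 Y)"

definition lift_cov ::
  "real ^ 'n ^ 'm \<Rightarrow> real ^ 'n ^ 'n \<Rightarrow> real ^ ('n + 'm) ^ ('n + 'm)" where
  "lift_cov F X = vcat (mat 1) F ** X ** transpose (vcat (mat 1) F)"

definition next_cov ::
  "real ^ 'n ^ 'n \<Rightarrow> real ^ 'm ^ 'n \<Rightarrow> real ^ 'n ^ 'n \<Rightarrow>
   real ^ ('n + 'm) ^ ('n + 'm) \<Rightarrow> real ^ 'n ^ 'n" where
  "next_cov A B W S = hcat A B ** S ** transpose (hcat A B) + W"

definition Phi ::
  "real ^ 'n ^ 'n \<Rightarrow> real ^ 'm ^ 'n \<Rightarrow> real ^ 'n ^ 'n \<Rightarrow>
   real ^ 'n ^ 'm \<Rightarrow> real ^ ('n + 'm) ^ ('n + 'm) \<Rightarrow> real ^ ('n + 'm) ^ ('n + 'm)" where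
  "Phi A B W F S = lift_cov F (next_cov A B W S)"

text \<open>
  Finite families indexed by \<open>0, \<dots>, N - 1\<close> are functions on \<open>nat\<close>; only their values
  below \<open>N\<close> are ever constrained or used.
\<close>

definition J_p ::
  "nat \<Rightarrow> real ^ 'n ^ 'n \<Rightarrow> real ^ 'm ^ 'n \<Rightarrow> real ^ 'n ^ 'n \<Rightarrow> real ^ 'n ^ 'n \<Rightarrow>
   real ^ 'm ^ 'm \<Rightarrow> real ^ 'n ^ 'n \<Rightarrow> (nat \<Rightarrow> real ^ ('n + 'm) ^ ('n + 'm)) \<Rightarrow> real" where
  "J_p N A B Q_f Q R W S =
     trace (Q_f ** next_cov A B W (S (N - 1))) +
     (\<Sum>k = 0..<N. trace (block_diag Q R ** S k))"

definition primal_feasible ::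
  "nat \<Rightarrow> real ^ 'n ^ 'n \<Rightarrow> real ^ 'm ^ 'n \<Rightarrow> real ^ 'n ^ 'n \<Rightarrow> real ^ 'n ^ 'n \<Rightarrow>
   ((nat \<Rightarrow> real ^ ('n + 'm) ^ ('n + 'm)) \<times> (nat \<Rightarrow> real ^ 'n ^ 'm)) set" where
  "primal_feasible N A B W_f W =
     {(S, F). (\<forall>k<N. symmetric_mat (S k)) \<and>
              (\<forall>k\<in>{1..<N}. Phi A B W (F k) (S (k - 1)) \<preceq> S k) \<and>
              lift_cov (F 0) W_f \<preceq> S 0}"

definition p_opt ::
  "nat \<Rightarrow> real ^ 'n ^ 'n \<Rightarrow> real ^ 'm ^ 'n \<Rightarrow> real ^ 'n ^ 'n \<Rightarrow> real ^ 'n ^ 'n \<Rightarrow>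
   real ^ 'm ^ 'm \<Rightarrow> real ^ 'n ^ 'n \<Rightarrow> real ^ 'n ^ 'n \<Rightarrow> ereal" where
  "p_opt N A B Q_f Q R W_f W =
     (INF (S, F) \<in> primal_feasible N A B W_f W. ereal (J_p N A B Q_f Q R W S))"

definition lagrangian ::
  "nat \<Rightarrow> real ^ 'n ^ 'n \<Rightarrow> real ^ 'm ^ 'n \<Rightarrow> real ^ 'n ^ 'n \<Rightarrow> real ^ 'n ^ 'n \<Rightarrow>
   real ^ 'm ^ 'm \<Rightarrow> real ^ 'n ^ 'n \<Rightarrow> real ^ 'n ^ 'n \<Rightarrow>
   (nat \<Rightarrow> real ^ ('n + 'm) ^ ('n + 'm)) \<Rightarrow> (nat \<Rightarrow> real ^ 'n ^ 'm) \<Rightarrow>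
   (nat \<Rightarrow> real ^ ('n + 'm) ^ ('n + 'm)) \<Rightarrow> (nat \<Rightarrow> real ^ ('n + 'm) ^ ('n + 'm)) \<Rightarrow> real" where
  "lagrangian N A B Q_f Q R W_f W S F P Pbar =
     J_p N A B Q_f Q R W S +
     (\<Sum>k = 1..<N. trace ((Phi A B W (F k) (S (k - 1)) - S k) ** P k)) +
     trace ((lift_cov (F 0) W_f - S 0) ** P 0) -
     (\<Sum>k = 0..<N. trace (S k ** Pbar k))"

definition d_opt ::
  "nat \<Rightarrow> real ^ 'n ^ 'n \<Rightarrow> real ^ 'm ^ 'n \<Rightarrow> real ^ 'n ^ 'n \<Rightarrow> real ^ 'n ^ 'n \<Rightarrow>
   real ^ 'm ^ 'm \<Rightarrow> real ^ 'n ^ 'n \<Rightarrow> real ^ 'n ^ 'n \<Rightarrow> ereal" where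
  "d_opt N A B Q_f Q R W_f W =
     (SUP (P, Pbar) \<in> {(P, Pbar). \<forall>k<N. psd (P k) \<and> psd (Pbar k)}.
        INF (S, F) \<in> {(S, F). \<forall>k<N. symmetric_mat (S k)}.
          ereal (lagrangian N A B Q_f Q R W_f W S F P Pbar))"

end

theory Submission
  imports Defs
begin

(* The S-part of the Lagrangian is linear, and the blocks of P k that multiply F k can be
   chosen to vanish. Let Y run backwards through the Riccati recursion from Y N = Q_f. The
   Schur complement identity

     [A B]^T Y (k+1) [A B] + diag Q R = diag (Y k) 0 + T k,   T k [I; F k] = 0,   T k psd,

   in which F k is the optimal feedback gain, shows that P k = diag (Y k) 0, Pbar k = T k
   makes the Lagrangian constant in (S, F). The primal point with gains F k and equality in
   every constraint attains the same value, because T k annihilates S k. Together with weak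
   duality this closes the gap. *)

section \<open>Matrix algebra\<close>

lemma matrix_add_rdistrib: "(A + B) ** C = A ** C + B ** (C :: real ^ 'p ^ 'n)"
  by (simp add: vec_eq_iff matrix_matrix_mult_def sum.distrib distrib_right)

lemma matrix_minus_left: "(- A) ** C = - (A ** (C :: real ^ 'p ^ 'n))"
  by (simp add: vec_eq_iff matrix_matrix_mult_def sum_negf)

lemma matrix_minus_right: "A ** (- C) = - (A ** (C :: real ^ 'p ^ 'n))"
  by (simp add: vec_eq_iff matrix_matrix_mult_def sum_negf)

lemma matrix_diff_rdistrib: "(A - B) ** C = A ** C - B ** (C :: real ^ 'p ^ 'n)"
  by (simp add: vec_eq_iff matrix_matrix_mult_def sum_subtractf left_diff_distrib)

lemma matrix_mult_zero [simp]:
  "A ** (0 :: real ^ 'p ^ 'n) = 0" "(0 :: real ^ 'n ^ 'm) ** C = 0"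
  by (simp_all add: vec_eq_iff matrix_matrix_mult_def)

lemma transpose_add: "transpose (X + Y :: real ^ 'c ^ 'r) = transpose X + transpose Y"
  by (simp add: vec_eq_iff transpose_def)

lemma transpose_minus: "transpose (- X :: real ^ 'c ^ 'r) = - transpose X"
  by (simp add: vec_eq_iff transpose_def)

lemma transpose_zero [simp]: "transpose (0 :: real ^ 'c ^ 'r) = 0"
  by (simp add: vec_eq_iff transpose_def)

section \<open>Block matrices indexed by a sum type\<close>

lemma sum_UNIV_Plus:
  "(\<Sum>x\<in>(UNIV :: ('a :: finite + 'b :: finite) set). f x)
    = (\<Sum>a\<in>UNIV. f (Inl a)) + (\<Sum>b\<in>UNIV. f (Inr b))"
  using sum.Plus [of UNIV UNIV f] by (simp add: UNIV_Plus_UNIV)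

lemma hcat_mult_vcat: "hcat X Y ** vcat U V = X ** U + Y ** V"
  by (simp add: vec_eq_iff matrix_matrix_mult_def hcat_def vcat_def sum_UNIV_Plus)

lemma vcat_mult: "vcat X Y ** Z = vcat (X ** Z) (Y ** Z)"
  by (auto simp add: vec_eq_iff matrix_matrix_mult_def vcat_def split: sum.split)

lemma mult_hcat: "Z ** hcat X Y = hcat (Z ** X) (Z ** Y)"
  by (auto simp add: vec_eq_iff matrix_matrix_mult_def hcat_def split: sum.split)

lemma transpose_hcat: "transpose (hcat X Y) = vcat (transpose X) (transpose Y)"
  by (auto simp add: vec_eq_iff transpose_def hcat_def vcat_def split: sum.split)

lemma vcat_add: "vcat X Y + vcat U V = vcat (X + U) (Y + V)"
  by (auto simp add: vec_eq_iff vcat_def split: sum.split)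

lemma hcat_add: "hcat X Y + hcat U V = hcat (X + U) (Y + V)"
  by (auto simp add: vec_eq_iff hcat_def split: sum.split)

lemma hcat_vcat: "hcat (vcat X Y) (vcat U V) = vcat (hcat X U) (hcat Y V)"
  by (auto simp add: vec_eq_iff hcat_def vcat_def split: sum.split)

lemma vcat_zero: "vcat 0 0 = 0"
  by (auto simp add: vec_eq_iff vcat_def split: sum.split)

lemma hcat_zero: "hcat 0 0 = 0"
  by (auto simp add: vec_eq_iff hcat_def split: sum.split)

text \<open>A plain zero block does not match the pattern of \<open>hcat_vcat\<close>, so this case
  and the next need rules of their own.\<close>

lemma hcat_vcat_zero: "hcat (vcat X Y) 0 = vcat (hcat X 0) (hcat Y 0)"
  by (simp add: hcat_vcat [symmetric] vcat_zero)

lemma hcat_zero_vcat: "hcat 0 (vcat X Y) = vcat (hcat 0 X) (hcat 0 Y)"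
  by (simp add: hcat_vcat [symmetric] vcat_zero)

lemma minus_vcat: "- vcat X Y = vcat (- X) (- Y)"
  by (auto simp add: vec_eq_iff vcat_def split: sum.split)

text \<open>These rules push \<open>vcat\<close> outside \<open>hcat\<close>, a normal form in which
  block matrices can be compared block by block.\<close>

lemmas block_simps =
  transpose_hcat mult_hcat vcat_mult hcat_mult_vcat hcat_add vcat_add minus_vcat
  hcat_vcat vcat_zero hcat_zero hcat_vcat_zero hcat_zero_vcat block_diag_def

section \<open>Semidefinite matrices\<close>

lemma psd_transpose: "psd X \<Longrightarrow> transpose X = X"
  by (simp add: psd_def symmetric_mat_def)

lemma psd_symmetric: "psd X \<Longrightarrow> symmetric_mat X"
  by (simp add: psd_def)

lemma psd_form_nonneg: "psd X \<Longrightarrow> 0 \<le> x \<bullet> (X *v x)"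
  by (simp add: psd_def)

lemma pd_imp_psd: "pd X \<Longrightarrow> psd X"
  by (metis inner_zero_left less_eq_real_def pd_def psd_def)

lemma psd_zero: "psd 0"
  by (simp add: psd_def symmetric_mat_def)

lemma psd_add: "psd X \<Longrightarrow> psd Y \<Longrightarrow> psd (X + Y)"
  by (simp add: psd_def symmetric_mat_def transpose_add matrix_vector_mult_add_rdistrib
      inner_add_right)

lemma psd_congruence:
  fixes X :: "real ^ 'n ^ 'n" and C :: "real ^ 'n ^ 'm"
  assumes "psd X"
  shows "psd (C ** X ** transpose C)"
proof -
  have "x \<bullet> ((C ** X ** transpose C) *v x) = (transpose C *v x) \<bullet> (X *v (transpose C *v x))" for x
    by (simp only: transpose_matrix_vector dot_lmul_matrix matrix_vector_mul_assoc [symmetric])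
  with assms show ?thesis
    by (simp add: psd_def symmetric_mat_def matrix_transpose_mul matrix_mul_assoc)
qed

lemma psd_congruence_transpose:
  "psd X \<Longrightarrow> psd (transpose C ** X ** C)"
  using psd_congruence [of X "transpose C"] by simp

lemma psd_block_diag:
  assumes "psd Q" "psd R"
  shows "psd (block_diag Q R)"
proof -
  \<comment> \<open>Each diagonal block is embedded by a congruence, so closure under congruence and
    sums suffices.\<close>
  have "block_diag Q R = transpose (hcat (mat 1) 0) ** Q ** hcat (mat 1) 0
      + transpose (hcat 0 (mat 1)) ** R ** hcat 0 (mat 1)"
    by (simp add: block_simps)
  then show ?thesis
    using assms by (simp add: psd_add psd_congruence_transpose)
qed

lemma pd_add_psd: "pd X \<Longrightarrow> psd Y \<Longrightarrow> pd (X + Y)"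
  by (simp add: pd_def psd_def symmetric_mat_def transpose_add matrix_vector_mult_add_rdistrib
      inner_add_right add_pos_nonneg)

lemma pd_right_inverse:
  fixes G :: "real ^ 'n ^ 'n"
  assumes "pd G"
  obtains H where "G ** H = mat 1"
proof -
  have "x = 0" if "G *v x = 0" for x
    using assms that by (metis inner_zero_right less_irrefl pd_def)
  then obtain H where "H ** G = mat 1"
    using matrix_left_invertible_ker [of G] by blast
  then show thesis
    using that matrix_left_right_inverse by blast
qed

section \<open>Nonnegativity of the trace pairing of semidefinite matrices\<close>

lemma symmetric_form_diff_axis:
  fixes X :: "real ^ 'n ^ 'n"
  assumes "transpose X = X"
  shows "(y - t *\<^sub>R axis i 1) \<bullet> (X *v (y - t *\<^sub>R axis i 1))
    = y \<bullet> (X *v y) - 2 * t * (X $ i \<bullet> y) + t\<^sup>2 * X $ i $ i"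
proof -
  have "X *v axis i 1 = X $ i"
    using assms by (metis matrix_vector_mult_basis column_transpose
        row_def vec_lambda_eta)
  then show ?thesis
    by (simp add: matrix_vector_mult_diff_distrib matrix_vector_mult_scaleR inner_diff_left
        inner_diff_right matrix_vector_mul_component inner_axis inner_axis'
        power2_eq_square inner_commute algebra_simps)
qed

text \<open>With a zero diagonal entry the form is affine in \<open>t\<close> along
  \<open>X $ i - t *\<^sub>R axis i 1\<close>. If the row were nonzero, the slope would be negative
  and the form would drop below zero.\<close>

lemma psd_diag_zero:
  fixes X :: "real ^ 'n ^ 'n"
  assumes X: "psd X" and "X $ i $ i = 0"
  shows "X $ i = 0"
proof (rule ccontr)
  assume nz: "X $ i \<noteq> 0"
  let ?y = "X $ i" and ?q = "X $ i \<bullet> (X *v X $ i)"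
  \<comment> \<open>Chosen so that the form takes the value -1.\<close>
  define t where "t = (?q + 1) / (2 * (?y \<bullet> ?y))"
  have "2 * t * (?y \<bullet> ?y) = ?q + 1"
    using nz by (simp add: t_def)
  moreover have "0 \<le> ?q - 2 * t * (?y \<bullet> ?y)"
    using psd_form_nonneg [OF X, of "?y - t *\<^sub>R axis i 1"] assms(2)
    by (simp add: symmetric_form_diff_axis [OF psd_transpose [OF X]])
  ultimately show False by simp
qed

text \<open>One step of symmetric Gaussian elimination.\<close>

lemma psd_pivot:
  fixes X :: "real ^ 'n ^ 'n"
  assumes X: "psd X" and pos: "X $ i $ i > 0"
  shows "psd (\<chi> a b. X $ a $ b - X $ i $ a * X $ i $ b / X $ i $ i)" (is "psd ?Z")
proof -
  have sym: "X $ a $ b = X $ b $ a" for a b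
    using psd_transpose [OF X] by (simp add: vec_eq_iff transpose_def)
  have "0 \<le> y \<bullet> (?Z *v y)" for y
  proof -
    have Z: "(?Z *v y) $ a = (X *v y) $ a - X $ i $ a * ((X $ i \<bullet> y) / X $ i $ i)" for a
      by (simp add: matrix_vector_mult_def inner_vec_def left_diff_distrib sum_subtractf
          sum_distrib_left sum_divide_distrib mult.assoc)
    have "y \<bullet> (?Z *v y) = y \<bullet> (X *v y) - (X $ i \<bullet> y) * ((X $ i \<bullet> y) / X $ i $ i)"
      unfolding inner_vec_def [of y] Z
      by (simp add: right_diff_distrib sum_subtractf inner_vec_def [of "X $ i"] sum_distrib_right
          sum_divide_distrib ac_simps)
    \<comment> \<open>Completing the square: this multiple of the axis vector minimizes the form of
      \<open>X\<close> over all shifts of \<open>y\<close> along axis \<open>i\<close>.\<close>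
    also have "\<dots> = (y - ((X $ i \<bullet> y) / X $ i $ i) *\<^sub>R axis i 1)
        \<bullet> (X *v (y - ((X $ i \<bullet> y) / X $ i $ i) *\<^sub>R axis i 1))"
      unfolding symmetric_form_diff_axis [OF psd_transpose [OF X]]
      using pos by (simp add: field_simps power2_eq_square)
    also have "\<dots> \<ge> 0" by (rule psd_form_nonneg [OF X])
    finally show ?thesis .
  qed
  moreover have "symmetric_mat ?Z"
    by (simp add: symmetric_mat_def vec_eq_iff transpose_def mult.commute sym)
  ultimately show ?thesis by (simp add: psd_def)
qed

text \<open>Induction on the number of nonzero rows of \<open>X\<close>. Elimination splits off a
  positive multiple of the rank-one matrix built from row \<open>i\<close>, whose pairing with
  \<open>Y\<close> is a value of the quadratic form of \<open>Y\<close>.\<close>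

lemma trace_psd_mult_nonneg:
  fixes X Y :: "real ^ 'n ^ 'n"
  assumes "psd X" "psd Y"
  shows "0 \<le> trace (X ** Y)"
  using assms(1)
proof (induction "card {i. X $ i \<noteq> 0}" arbitrary: X rule: less_induct)
  case less
  show ?case
  proof (cases "X = 0")
    case True
    then show ?thesis by (simp add: trace_def)
  next
    case False
    then obtain i where i: "X $ i \<noteq> 0" by (auto simp: vec_eq_iff [of X])
    have "X $ i $ i \<ge> 0"
      using psd_form_nonneg [OF less.prems, of "axis i 1"]
      by (simp add: inner_axis' matrix_vector_mul_component inner_axis)
    with psd_diag_zero [OF less.prems] i have pos: "X $ i $ i > 0" by force
    let ?Z = "\<chi> a b. X $ a $ b - X $ i $ a * X $ i $ b / X $ i $ i"
    have sym: "X $ a $ b = X $ b $ a" for a b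
      using psd_transpose [OF less.prems] by (simp add: vec_eq_iff transpose_def)
    \<comment> \<open>Elimination clears row \<open>i\<close> and, by symmetry of \<open>X\<close>,
      keeps zero rows zero, so the count drops.\<close>
    have "?Z $ a = 0" if "X $ a = 0" for a
      using that sym [of i a] by (simp add: vec_eq_iff)
    moreover have "?Z $ i = 0"
      using pos by (simp add: vec_eq_iff)
    ultimately have "{a. ?Z $ a \<noteq> 0} \<subset> {a. X $ a \<noteq> 0}"
      using i by blast
    then have "card {a. ?Z $ a \<noteq> 0} < card {a. X $ a \<noteq> 0}"
      by (intro psubset_card_mono) auto
    then have Z: "0 \<le> trace (?Z ** Y)"
      using psd_pivot [OF less.prems pos] by (rule less.hyps)
    have "trace (X ** Y) = trace (?Z ** Y) + (X $ i \<bullet> (Y *v X $ i)) / X $ i $ i"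
    proof -
      have Y: "Y $ a $ b = Y $ b $ a" for a b
        using psd_transpose [OF assms(2)] by (simp add: vec_eq_iff transpose_def)
      have "X $ i \<bullet> (Y *v X $ i) = (\<Sum>a\<in>UNIV. \<Sum>b\<in>UNIV. X $ i $ a * X $ i $ b * Y $ b $ a)"
        by (simp add: inner_vec_def matrix_vector_mult_def sum_distrib_left ac_simps Y)
      then show ?thesis
        by (simp add: trace_def matrix_matrix_mult_def left_diff_distrib sum_subtractf
            sum_divide_distrib)
    qed
    then show ?thesis
      using Z pos psd_form_nonneg [OF assms(2), of "X $ i"] by simp
  qed
qed

section \<open>The Riccati recursion\<close>

lemma lift_cov_psd: "psd X \<Longrightarrow> psd (lift_cov F X)"
  by (simp add: lift_cov_def psd_congruence)

lemma next_cov_psd: "psd S \<Longrightarrow> psd W \<Longrightarrow> psd (next_cov A B W S)"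
  by (simp add: next_cov_def psd_add psd_congruence)

lemma Phi_psd: "psd S \<Longrightarrow> psd W \<Longrightarrow> psd (Phi A B W F S)"
  by (simp add: Phi_def lift_cov_psd next_cov_psd)

text \<open>Completing the square in u: the form of the left-hand matrix at (x, u) equals x . Yx +
  (u - Fx) . G(u - Fx). The second summand is the form of \<open>T\<close> and vanishes on the graph
  u = Fx.\<close>

lemma riccati_step:
  fixes A :: "real ^ 'n ^ 'n" and B :: "real ^ 'm ^ 'n"
  assumes X: "psd X" and Q: "psd Q" and R: "pd R"
  obtains Y :: "real ^ 'n ^ 'n" and F :: "real ^ 'n ^ 'm" and T
  where "psd Y" "psd T" "T ** vcat (mat 1) F = 0"
    and "transpose (hcat A B) ** X ** hcat A B + block_diag Q R = block_diag Y 0 + T"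
proof -
  define G where "G = transpose B ** X ** B + R"
  have G: "pd G"
    using pd_add_psd [OF R psd_congruence_transpose [OF X, of B]] by (simp add: G_def add.commute)
  have GT: "transpose G = G" using G by (simp add: pd_def symmetric_mat_def)
  obtain H where H: "G ** H = mat 1" using pd_right_inverse [OF G] .
  \<comment> \<open>The stationary point in u, where Gu + B^T X A x = 0.\<close>
  define F where "F = - (H ** (transpose B ** X ** A))"
  have GF: "G ** F = - (transpose B ** X ** A)"
    by (simp add: F_def matrix_minus_right matrix_mul_assoc [of G H] H)
  have FG: "transpose F ** G = - (transpose A ** X ** B)"
    using arg_cong [OF GF, of transpose]
    by (simp add: matrix_transpose_mul GT transpose_minus psd_transpose [OF X] matrix_mul_assoc)
  \<comment> \<open>The Schur complement of the block \<open>G\<close>, written through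
    \<open>F\<close> instead of the inverse.\<close>
  define Y where "Y = transpose A ** X ** A + Q - transpose F ** G ** F"
  \<comment> \<open>\<open>K\<close> maps (x, u) to the deviation u - Fx from the optimal
    feedback.\<close>
  define K where "K = hcat (- F) (mat 1)"
  define T where "T = transpose K ** G ** K"
  have "K ** vcat (mat 1) F = 0"
    by (simp add: K_def hcat_mult_vcat)
  then have TV: "T ** vcat (mat 1) F = 0"
    by (simp add: T_def matrix_mul_assoc [symmetric])
  have eq: "transpose (hcat A B) ** X ** hcat A B + block_diag Q R = block_diag Y 0 + T"
    by (simp add: T_def K_def block_simps transpose_minus matrix_minus_left matrix_minus_right
        FG GF Y_def) (simp add: G_def)
  \<comment> \<open>\<open>Y\<close> is defined as a difference, so its semidefiniteness is not
    visible. It is the compression of the whole block matrix to the graph of \<open>F\<close>, where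
    \<open>T\<close> contributes nothing.\<close>
  have "transpose (vcat (mat 1) F) ** (block_diag Y 0 + T) ** vcat (mat 1) F
      = transpose (vcat (mat 1) F) ** vcat Y 0"
    using TV by (simp add: matrix_mul_assoc [symmetric] matrix_add_rdistrib block_simps)
  also have "\<dots> = Y"
    using transpose_hcat [of "mat 1" "transpose F"]
    by (metis hcat_mult_vcat matrix_mul_lid matrix_mult_zero(1) add.right_neutral
        transpose_mat transpose_transpose)
  finally have Y: "Y = transpose (vcat (mat 1) F) ** (block_diag Y 0 + T) ** vcat (mat 1) F" by simp
  have "psd (block_diag Y 0 + T)"
    unfolding eq [symmetric]
    by (intro psd_add psd_congruence_transpose psd_block_diag X Q pd_imp_psd R)
  then have "psd Y"
    using Y psd_congruence_transpose by metis
  moreover have "psd T"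
    by (simp add: T_def psd_congruence_transpose pd_imp_psd G)
  ultimately show thesis using that TV eq by blast
qed

lemma riccati_sequence:
  fixes A :: "real ^ 'n ^ 'n" and B :: "real ^ 'm ^ 'n"
  assumes Qf: "psd Q_f" and Q: "psd Q" and R: "pd R"
  obtains Y :: "nat \<Rightarrow> real ^ 'n ^ 'n" and F :: "nat \<Rightarrow> real ^ 'n ^ 'm" and T
  where "Y N = Q_f" "\<And>k. psd (Y k)" "\<And>k. psd (T k)" "\<And>k. T k ** vcat (mat 1) (F k) = 0"
    and "\<And>k. k < N \<Longrightarrow> transpose (hcat A B) ** Y (Suc k) ** hcat A B + block_diag Q R
           = block_diag (Y k) 0 + T k"
proof -
  have "\<exists>Y (F :: real ^ 'n ^ 'm) T. psd Y \<and> psd T \<and> T ** vcat (mat 1) F = 0 \<and>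
      transpose (hcat A B) ** X ** hcat A B + block_diag Q R = block_diag Y 0 + T"
    if "psd X" for X
    using riccati_step [OF that Q R] by metis
  then obtain y and f :: "real ^ 'n ^ 'n \<Rightarrow> real ^ 'n ^ 'm" and t where
    step: "\<And>X. psd X \<Longrightarrow> psd (y X) \<and> psd (t X) \<and> t X ** vcat (mat 1) (f X) = 0 \<and>
      transpose (hcat A B) ** X ** hcat A B + block_diag Q R = block_diag (y X) 0 + t X"
    by metis
  \<comment> \<open>Backward recursion as forward iteration. Truncated subtraction gives
    \<open>Q_f\<close> for all \<open>k\<close> at or beyond \<open>N\<close>, so \<open>Y k\<close>
    is semidefinite for every \<open>k\<close>.\<close>
  define Y where "Y k = (y ^^ (N - k)) Q_f" for k
  have psd_Y: "psd (Y k)" for k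
  proof -
    have "psd ((y ^^ j) Q_f)" for j
      by (induction j) (use Qf step in auto)
    then show ?thesis by (simp add: Y_def)
  qed
  have "Y k = y (Y (Suc k))" if "k < N" for k
  proof -
    have "N - k = Suc (N - Suc k)" using that by simp
    then show ?thesis by (simp add: Y_def)
  qed
  with psd_Y step show thesis
    by (intro that [of Y "\<lambda>k. t (Y (Suc k))" "\<lambda>k. f (Y (Suc k))"]) (auto simp: Y_def)
qed

section \<open>Duality\<close>

text \<open>The upper left block of \<open>lift_cov F M\<close> is \<open>M\<close> whatever
  \<open>F\<close> is. This is what removes the gains from the Lagrangian.\<close>

lemma trace_lift_cov_block_diag:
  fixes F :: "real ^ 'n ^ 'm" and M Y :: "real ^ 'n ^ 'n"
  shows "trace (lift_cov F M ** block_diag Y 0) = trace (M ** Y)"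
proof -
  let ?V = "vcat (mat 1) F" and ?E = "hcat (mat 1) 0 :: real ^ ('n + 'm) ^ 'n"
  have EV: "?E ** ?V = mat 1"
    by (simp add: hcat_mult_vcat)
  have "block_diag Y 0 = transpose ?E ** Y ** ?E"
    by (simp add: block_simps)
  then have "trace (lift_cov F M ** block_diag Y 0)
      = trace ((?V ** M ** transpose ?V ** transpose ?E ** Y) ** ?E)"
    by (simp add: lift_cov_def matrix_mul_assoc)
  also have "\<dots> = trace ((?E ** ?V) ** M ** transpose (?E ** ?V) ** Y)"
    by (subst trace_mul_sym) (simp add: matrix_transpose_mul matrix_mul_assoc)
  finally show ?thesis by (simp add: EV)
qed

text \<open>Complementary slackness for \<open>Pbar\<close>: by symmetry \<open>T\<close> is also
  annihilated from the left by the transposed factor, the last one in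
  \<open>lift_cov F M\<close>.\<close>

lemma trace_lift_cov_annihilated:
  assumes "psd T" "T ** vcat (mat 1) F = 0"
  shows "trace (lift_cov F M ** T) = 0"
proof -
  have "transpose (vcat (mat 1) F) ** T = 0"
    using arg_cong [OF assms(2), of transpose] psd_transpose [OF assms(1)]
    by (simp add: matrix_transpose_mul)
  then have "lift_cov F M ** T = 0"
    by (simp add: lift_cov_def matrix_mul_assoc [symmetric])
  then show ?thesis by (simp add: trace_def)
qed

text \<open>Passes to the adjoint of the linear part of \<open>next_cov\<close> under the trace
  pairing, which is the map in the Riccati step.\<close>

lemma trace_next_cov:
  "trace (next_cov A B W S ** Y)
    = trace (S ** (transpose (hcat A B) ** Y ** hcat A B)) + trace (W ** Y)"
proof -
  have "trace (hcat A B ** (S ** transpose (hcat A B) ** Y))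
      = trace (S ** (transpose (hcat A B) ** Y ** hcat A B))"
    by (subst trace_mul_sym) (simp add: matrix_mul_assoc)
  then show ?thesis
    by (simp add: next_cov_def matrix_add_rdistrib trace_add matrix_mul_assoc)
qed

text \<open>Collecting the terms in each \<open>S k\<close> leaves its pairing with the difference
  of the two sides of \<open>step\<close>, which is zero. Only the constants from \<open>W\<close>
  and \<open>W_f\<close> survive.\<close>

lemma lagrangian_riccati:
  assumes "N \<ge> 1" and YN: "Y N = Q_f"
    and step: "\<And>k. k < N \<Longrightarrow> transpose (hcat A B) ** Y (Suc k) ** hcat A B + block_diag Q R
           = block_diag (Y k) 0 + T k"
  shows "lagrangian N A B Q_f Q R W_f W S F (\<lambda>k. block_diag (Y k) 0) T
    = trace (W_f ** Y 0) + (\<Sum>k<N. trace (W ** Y (Suc k)))"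
proof -
  obtain n where N: "N = Suc n" using \<open>N \<ge> 1\<close> by (cases N) auto
  define a where "a k = trace (next_cov A B W (S k) ** Y (Suc k))" for k
  define s where "s k = trace (S k ** block_diag (Y k) 0)" for k
  define d where "d k = trace (block_diag Q R ** S k)" for k
  define q where "q k = trace (S k ** T k)" for k
  \<comment> \<open>Here \<open>a k\<close> comes from the constraint at \<open>k + 1\<close>,
    \<open>d k\<close> from the cost, \<open>s k\<close> from the constraint at \<open>k\<close>,
    and \<open>q k\<close> from \<open>Pbar\<close>.\<close>
  have stage: "a k + d k - s k - q k = trace (W ** Y (Suc k))" if "k < N" for k
  proof -
    have "trace (S k ** (transpose (hcat A B) ** Y (Suc k) ** hcat A B)) + d k = s k + q k"
      using arg_cong [OF step [OF that], of "\<lambda>Z. trace (S k ** Z)"]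
      by (simp add: matrix_add_ldistrib trace_add s_def q_def d_def
          trace_mul_sym [of "block_diag Q R"])
    then show ?thesis by (simp add: a_def trace_next_cov)
  qed
  \<comment> \<open>The constraint at \<open>k\<close> involves \<open>S (k - 1)\<close>, so only
    \<open>a 0\<close> to \<open>a (n - 1)\<close> arise here. The missing \<open>a n\<close> is the
    terminal cost, as \<open>Y N = Q_f\<close>; the missing \<open>s 0\<close> comes from the
    initial constraint.\<close>
  have "(\<Sum>k = 1..<N. trace ((Phi A B W (F k) (S (k - 1)) - S k) ** block_diag (Y k) 0))
      = (\<Sum>k = 1..<N. a (k - 1) - s k)"
    by (intro sum.cong)
      (auto simp: a_def s_def Phi_def matrix_diff_rdistrib trace_sub trace_lift_cov_block_diag)
  also have "\<dots> = (\<Sum>k<n. a k) - (\<Sum>k = 1..<N. s k)"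
    by (simp add: sum_subtractf N sum.shift_bounds_Suc_ivl lessThan_atLeast0 del: sum.op_ivl_Suc)
  finally have "lagrangian N A B Q_f Q R W_f W S F (\<lambda>k. block_diag (Y k) 0) T
      = a n + (\<Sum>k<N. d k) + ((\<Sum>k<n. a k) - (\<Sum>k = 1..<N. s k))
        + (trace (W_f ** Y 0) - s 0) - (\<Sum>k<N. q k)"
    using YN
    by (simp add: lagrangian_def J_p_def a_def s_def d_def q_def N matrix_diff_rdistrib trace_sub
        trace_lift_cov_block_diag trace_mul_sym [of Q_f] lessThan_atLeast0 del: sum.op_ivl_Suc)
  also have "(\<Sum>k = 1..<N. s k) = (\<Sum>k<N. s k) - s 0"
    by (simp add: N sum.atLeast_Suc_lessThan lessThan_atLeast0 del: sum.op_ivl_Suc)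
  also have "a n + (\<Sum>k<N. d k) + ((\<Sum>k<n. a k) - ((\<Sum>k<N. s k) - s 0))
        + (trace (W_f ** Y 0) - s 0) - (\<Sum>k<N. q k)
      = trace (W_f ** Y 0) + (\<Sum>k<N. a k + d k - s k - q k)"
    by (simp add: N sum.distrib sum_subtractf)
  finally show ?thesis by (simp add: stage)
qed

section \<open>Weak duality\<close>

lemma loewner_le_psd: "X \<preceq> Y \<Longrightarrow> psd X \<Longrightarrow> psd Y"
  using psd_add [of "Y - X" X] by (simp add: loewner_le_def)

lemma lagrangian_le_J_p:
  fixes A :: "real ^ 'n ^ 'n" and B :: "real ^ 'm ^ 'n"
  assumes "N \<ge> 1" "psd W_f" "psd W"
    and feas: "(S, F) \<in> primal_feasible N A B W_f W"
    and P: "\<And>k. k < N \<Longrightarrow> psd (P k) \<and> psd (Pbar k)"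
  shows "lagrangian N A B Q_f Q R W_f W S F P Pbar \<le> J_p N A B Q_f Q R W S"
proof -
  have S0: "lift_cov (F 0) W_f \<preceq> S 0"
    and Sk: "\<And>k. k \<in> {1..<N} \<Longrightarrow> Phi A B W (F k) (S (k - 1)) \<preceq> S k"
    using feas by (auto simp: primal_feasible_def)
  \<comment> \<open>The primal problem does not impose semidefiniteness of \<open>S k\<close>, the
    constraint dual to \<open>Pbar k\<close>. Feasibility implies it, since each lower bound is
    semidefinite by induction.\<close>
  have S: "psd (S k)" if "k < N" for k
    using that
  proof (induction k)
    case 0
    then show ?case using S0 assms(2) by (auto intro: loewner_le_psd lift_cov_psd)
  next
    case (Suc k)
    then show ?case
      using Sk [of "Suc k"] assms(3) by (auto intro: loewner_le_psd Phi_psd)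
  qed
  have neg: "trace ((X - Z) ** U) \<le> 0" if "X \<preceq> Z" "psd U" for X Z U :: "real ^ ('n + 'm) ^ ('n + 'm)"
    using trace_psd_mult_nonneg [of "Z - X" U] that
    by (simp add: loewner_le_def matrix_diff_rdistrib trace_sub)
  have "(\<Sum>k = 1..<N. trace ((Phi A B W (F k) (S (k - 1)) - S k) ** P k)) \<le> 0"
    by (intro sum_nonpos neg Sk) (auto simp: P)
  moreover have "trace ((lift_cov (F 0) W_f - S 0) ** P 0) \<le> 0"
    using S0 P [of 0] assms(1) by (intro neg) auto
  moreover have "(\<Sum>k = 0..<N. trace (S k ** Pbar k)) \<ge> 0"
    by (intro sum_nonneg trace_psd_mult_nonneg) (auto simp: P S)
  ultimately show ?thesis by (simp add: lagrangian_def)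
qed

lemma weak_duality:
  fixes A :: "real ^ 'n ^ 'n" and B :: "real ^ 'm ^ 'n"
  assumes "N \<ge> 1" "psd W_f" "psd W"
  shows "d_opt N A B Q_f Q R W_f W \<le> p_opt N A B Q_f Q R W_f W"
  unfolding d_opt_def p_opt_def
proof (intro SUP_least INF_greatest, clarify)
  fix P Pbar S :: "nat \<Rightarrow> real ^ ('n + 'm) ^ ('n + 'm)" and F
  assume P: "\<forall>k<N. psd (P k) \<and> psd (Pbar k)"
    and feas: "(S, F) \<in> primal_feasible N A B W_f W"
  show "(INF (S, F) \<in> {(S, F). \<forall>k<N. symmetric_mat (S k)}.
      ereal (lagrangian N A B Q_f Q R W_f W S F P Pbar)) \<le> ereal (J_p N A B Q_f Q R W S)"
    using feas P lagrangian_le_J_p [OF assms feas]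
    by (intro INF_lower2 [of "(S, F)"]) (auto simp: primal_feasible_def)
qed

theorem theorem1:
  fixes N :: nat
    and A :: "real ^ 'n ^ 'n"
    and B :: "real ^ 'm ^ 'n"
    and Q_f Q W_f W :: "real ^ 'n ^ 'n"
    and R :: "real ^ 'm ^ 'm"
  assumes "N \<ge> 1"
    and "psd Q_f" and "psd Q" and "pd R" and "pd W_f" and "pd W"
  shows "p_opt N A B Q_f Q R W_f W = d_opt N A B Q_f Q R W_f W"
proof (rule antisym)
  obtain Y :: "nat \<Rightarrow> real ^ 'n ^ 'n" and F :: "nat \<Rightarrow> real ^ 'n ^ 'm" and T
    where YN: "Y N = Q_f" and Y: "\<And>k. psd (Y k)" and T: "\<And>k. psd (T k)"
      and TF: "\<And>k. T k ** vcat (mat 1) (F k) = 0"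
      and step: "\<And>k. k < N \<Longrightarrow> transpose (hcat A B) ** Y (Suc k) ** hcat A B + block_diag Q R
           = block_diag (Y k) 0 + T k"
    using riccati_sequence [OF assms(2-4), of N A B] by metis
  define V where "V = trace (W_f ** Y 0) + (\<Sum>k<N. trace (W ** Y (Suc k)))"
  have L: "lagrangian N A B Q_f Q R W_f W S F' (\<lambda>k. block_diag (Y k) 0) T = V" for S F'
    unfolding V_def by (rule lagrangian_riccati [where T = T, OF assms(1) YN step])
  \<comment> \<open>The covariance trajectory under the Riccati gains, with equality in every
    constraint.\<close>
  define S where "S = rec_nat (lift_cov (F 0) W_f) (\<lambda>k. Phi A B W (F (Suc k)))"
  have S0: "S 0 = lift_cov (F 0) W_f" and SS: "\<And>k. S (Suc k) = Phi A B W (F (Suc k)) (S k)"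
    by (simp_all add: S_def)
  have S_step: "S k = Phi A B W (F k) (S (k - 1))" if "1 \<le> k" for k
    using that SS [of "k - 1"] by simp
  have "psd (S k)" for k
    by (induction k) (auto simp: S0 SS intro: lift_cov_psd Phi_psd pd_imp_psd assms)
  then have feas: "(S, F) \<in> primal_feasible N A B W_f W"
    using S_step
    by (auto simp: primal_feasible_def loewner_le_def psd_zero psd_symmetric S0)
  have "trace (S k ** T k) = 0" for k
    by (cases k) (simp_all add: S0 SS Phi_def trace_lift_cov_annihilated T TF)
  moreover have "(\<Sum>k = 1..<N. trace ((Phi A B W (F k) (S (k - 1)) - S k) ** block_diag (Y k) 0)) = 0"
    using S_step by (intro sum.neutral) (auto simp: trace_def)
  \<comment> \<open>All multiplier terms vanish at this point, so its cost is the constant value of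
    the Lagrangian.\<close>
  ultimately have "J_p N A B Q_f Q R W S = V"
    unfolding L [of S F, symmetric] lagrangian_def by (simp add: S0 trace_def [of 0])
  then have "p_opt N A B Q_f Q R W_f W \<le> ereal V"
    unfolding p_opt_def using feas by (intro INF_lower2 [of "(S, F)"]) auto
  also have "ereal V \<le> d_opt N A B Q_f Q R W_f W"
    unfolding d_opt_def
    \<comment> \<open>The inner infimum at these multipliers is over a constant.\<close>
    by (intro SUP_upper2 [of "(\<lambda>k. block_diag (Y k) 0, T)"])
      (auto simp: L Y T psd_block_diag psd_zero intro!: INF_greatest)
  finally show "p_opt N A B Q_f Q R W_f W \<le> d_opt N A B Q_f Q R W_f W" .
  show "d_opt N A B Q_f Q R W_f W \<le> p_opt N A B Q_f Q R W_f W"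
    using assms by (intro weak_duality pd_imp_psd)
qed

end
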